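(* Let $A,B$ be profinite groups and let $G\le A\times B$ be a subgroup, where $A\times B$ has the product topology and $G$ has the subspace topology. Let $\{\overline{G}_1,\overline{G}_2,G_2,\theta_1\}$ be the Goursat decomposition of $G$, topologized as described in the context. Then $G$ is a profinite group if and only if each of the subgroups $\overline{G}_1,\overline{G}_2,G_2$ in the Goursat decomposition of $G$ is a profinite group and $\theta_1$ is continuous.
   Context: A topological group is profinite if it is an inverse limit of finite discrete groups; equivalently, it is Hausdorff, compact and totally disconnected. For a subgroup $G\le A\times B$ with projections $\pi_1:A\times B\to A$, $\pi_2:A\times B\to B$, the Goursat decomposition of $G$ is $\{\overline{G}_1,\overline{G}_2,G_2,\theta_1\}$, where $\overline{G}_1=\pi_1(G)\le A$, $\overline{G}_2=\pi_2(G)\le B$, $G_2=\{b\in B\mid (e,b)\in G\}\unlhd\overline{G}_2$, and $\theta_1:\overline{G}_1\twoheadrightarrow\overline{G}_2/G_2$ is the well-defined surjective homomorphism $\theta_1(a)=[b]$ for any $b$ with $(a,b)\in G$. Topologies: for $i=1,2$, $\overline{G}_i$ (which here is not a topological closure) carries the quotient (identification) topology from the surjection $\pi_i|_G:G\twoheadrightarrow\overline{G}_i$; $G_2\unlhd\overline{G}_2$ carries the subspace topology from $\overline{G}_2$; $\overline{G}_2/G_2$ carries the quotient topology. *)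

theory Defs
  imports "HOL-Analysis.Analysis" "HOL-Algebra.Coset"
begin

definition totally_disconnected_space :: "'a topology \<Rightarrow> bool" where
  "totally_disconnected_space X \<longleftrightarrow>
     (\<forall>x \<in> topspace X. connected_component_of_set X x = {x})"

definition topological_group :: "('a, 'm) monoid_scheme \<Rightarrow> 'a topology \<Rightarrow> bool" where
  "topological_group G X \<longleftrightarrow>
     group G \<and> topspace X = carrier G \<and>
     continuous_map (prod_topology X X) X (\<lambda>(x, y). x \<otimes>\<^bsub>G\<^esub> y) \<and>
     continuous_map X X (\<lambda>x. inv\<^bsub>G\<^esub> x)"

definition profinite_group :: "('a, 'm) monoid_scheme \<Rightarrow> 'a topology \<Rightarrow> bool" where
  "profinite_group G X \<longleftrightarrow>
     topological_group G X \<and>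
     Hausdorff_space X \<and> compact_space X \<and> totally_disconnected_space X"

text \<open>The identification topology on the image of \<open>f\<close>; see \<open>quotient_map_quotient_topology\<close>.\<close>

definition quotient_topology :: "'a topology \<Rightarrow> ('a \<Rightarrow> 'b) \<Rightarrow> 'b topology" where
  "quotient_topology X f =
     topology (\<lambda>U. U \<subseteq> f ` topspace X \<and> openin X {x \<in> topspace X. f x \<in> U})"

lemma openin_quotient_topology:
  "openin (quotient_topology X f) U \<longleftrightarrow>
     U \<subseteq> f ` topspace X \<and> openin X {x \<in> topspace X. f x \<in> U}"
proof -
  have "istopology (\<lambda>U. U \<subseteq> f ` topspace X \<and> openin X {x \<in> topspace X. f x \<in> U})"
    unfolding istopology_def
  proof (intro conjI allI impI)
    fix S T
    assume S: "S \<subseteq> f ` topspace X \<and> openin X {x \<in> topspace X. f x \<in> S}"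
      and T: "T \<subseteq> f ` topspace X \<and> openin X {x \<in> topspace X. f x \<in> T}"
    show "S \<inter> T \<subseteq> f ` topspace X" using S by blast
    have "{x \<in> topspace X. f x \<in> S \<inter> T} =
          {x \<in> topspace X. f x \<in> S} \<inter> {x \<in> topspace X. f x \<in> T}" by blast
    then show "openin X {x \<in> topspace X. f x \<in> S \<inter> T}" using S T by auto
  next
    fix \<K>
    assume K: "\<forall>K\<in>\<K>. K \<subseteq> f ` topspace X \<and> openin X {x \<in> topspace X. f x \<in> K}"
    then show "\<Union>\<K> \<subseteq> f ` topspace X" by blast
    have "{x \<in> topspace X. f x \<in> \<Union>\<K>} = (\<Union>K\<in>\<K>. {x \<in> topspace X. f x \<in> K})" by blast
    then show "openin X {x \<in> topspace X. f x \<in> \<Union>\<K>}" using K by auto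
  qed
  then show ?thesis by (simp add: quotient_topology_def)
qed

lemma topspace_quotient_topology: "topspace (quotient_topology X f) = f ` topspace X"
proof
  show "topspace (quotient_topology X f) \<subseteq> f ` topspace X"
    using openin_topspace openin_quotient_topology by metis
  have "{x \<in> topspace X. f x \<in> f ` topspace X} = topspace X" by blast
  then have "openin (quotient_topology X f) (f ` topspace X)"
    by (simp add: openin_quotient_topology)
  then show "f ` topspace X \<subseteq> topspace (quotient_topology X f)" by (rule openin_subset)
qed

lemma quotient_map_quotient_topology: "quotient_map X (quotient_topology X f) f"
  by (simp add: quotient_map_def topspace_quotient_topology openin_quotient_topology)

text \<open>The Goursat decomposition of a subgroup \<open>G\<close> of \<open>A \<times>\<times> B\<close>. The groups are records, so
  that the operations of \<open>A\<close> and \<open>B\<close> are retained.\<close>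

definition goursat_bar1 :: "('a, 'm) monoid_scheme \<Rightarrow> ('a \<times> 'b) set \<Rightarrow> ('a, 'm) monoid_scheme"
  where "goursat_bar1 A G = A\<lparr>carrier := fst ` G\<rparr>"

definition goursat_bar2 :: "('b, 'n) monoid_scheme \<Rightarrow> ('a \<times> 'b) set \<Rightarrow> ('b, 'n) monoid_scheme"
  where "goursat_bar2 B G = B\<lparr>carrier := snd ` G\<rparr>"

definition goursat_ker2 :: "('a, 'm) monoid_scheme \<Rightarrow> ('b, 'n) monoid_scheme \<Rightarrow>
    ('a \<times> 'b) set \<Rightarrow> 'b set"
  where "goursat_ker2 A B G = {b \<in> carrier B. (\<one>\<^bsub>A\<^esub>, b) \<in> G}"

definition goursat_2 :: "('a, 'm) monoid_scheme \<Rightarrow> ('b, 'n) monoid_scheme \<Rightarrow>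
    ('a \<times> 'b) set \<Rightarrow> ('b, 'n) monoid_scheme"
  where "goursat_2 A B G = B\<lparr>carrier := goursat_ker2 A B G\<rparr>"

definition goursat_class :: "('a, 'm) monoid_scheme \<Rightarrow> ('b, 'n) monoid_scheme \<Rightarrow>
    ('a \<times> 'b) set \<Rightarrow> 'b \<Rightarrow> 'b set"
  where "goursat_class A B G b = goursat_ker2 A B G #>\<^bsub>goursat_bar2 B G\<^esub> b"

text \<open>The definite description is justified by \<open>goursat_theta_eq\<close>.\<close>

definition goursat_theta :: "('a, 'm) monoid_scheme \<Rightarrow> ('b, 'n) monoid_scheme \<Rightarrow>
    ('a \<times> 'b) set \<Rightarrow> 'a \<Rightarrow> 'b set"
  where "goursat_theta A B G a = (THE c. \<exists>b. (a, b) \<in> G \<and> c = goursat_class A B G b)"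

definition goursat_bar1_topology :: "'a topology \<Rightarrow> 'b topology \<Rightarrow> ('a \<times> 'b) set \<Rightarrow> 'a topology"
  where "goursat_bar1_topology X Y G =
    quotient_topology (subtopology (prod_topology X Y) G) fst"

definition goursat_bar2_topology :: "'a topology \<Rightarrow> 'b topology \<Rightarrow> ('a \<times> 'b) set \<Rightarrow> 'b topology"
  where "goursat_bar2_topology X Y G =
    quotient_topology (subtopology (prod_topology X Y) G) snd"

definition goursat_2_topology :: "('a, 'm) monoid_scheme \<Rightarrow> ('b, 'n) monoid_scheme \<Rightarrow>
    'a topology \<Rightarrow> 'b topology \<Rightarrow> ('a \<times> 'b) set \<Rightarrow> 'b topology"
  where "goursat_2_topology A B X Y G =
    subtopology (goursat_bar2_topology X Y G) (goursat_ker2 A B G)"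

definition goursat_quot_topology :: "('a, 'm) monoid_scheme \<Rightarrow> ('b, 'n) monoid_scheme \<Rightarrow>
    'a topology \<Rightarrow> 'b topology \<Rightarrow> ('a \<times> 'b) set \<Rightarrow> 'b set topology"
  where "goursat_quot_topology A B X Y G =
    quotient_topology (goursat_bar2_topology X Y G) (goursat_class A B G)"

context
  fixes A :: "('a, 'm) monoid_scheme" and B :: "('b, 'n) monoid_scheme" and G :: "('a \<times> 'b) set"
  assumes A: "group A" and B: "group B" and G: "subgroup G (A \<times>\<times> B)"
begin

interpretation A: group A by (rule A)
interpretation B: group B by (rule B)
interpretation AB: group "A \<times>\<times> B" by (rule DirProd_group[OF A B])

private lemma G_memD: "(a, b) \<in> G \<Longrightarrow> a \<in> carrier A \<and> b \<in> carrier B"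
  using subgroup.subset[OF G] by (auto simp: DirProd_def)

private lemma G_mult: "(a, b) \<in> G \<Longrightarrow> (a', b') \<in> G \<Longrightarrow> (a \<otimes>\<^bsub>A\<^esub> a', b \<otimes>\<^bsub>B\<^esub> b') \<in> G"
  using subgroup.m_closed[OF G, of "(a, b)" "(a', b')"] by (simp add: DirProd_def)

private lemma G_inv: "(a, b) \<in> G \<Longrightarrow> (inv\<^bsub>A\<^esub> a, inv\<^bsub>B\<^esub> b) \<in> G"
  using subgroup.m_inv_closed[OF G, of "(a, b)"] G_memD[of a b] inv_DirProd[OF A B] by auto

private lemma G_one: "(\<one>\<^bsub>A\<^esub>, \<one>\<^bsub>B\<^esub>) \<in> G"
  using subgroup.one_closed[OF G] by (simp add: DirProd_def)

lemma subgroup_goursat_bar1: "subgroup (fst ` G) A"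
proof (rule A.subgroupI)
  show "fst ` G \<subseteq> carrier A" using G_memD by auto
  show "fst ` G \<noteq> {}" using G_one by auto
  show "\<And>a. a \<in> fst ` G \<Longrightarrow> inv\<^bsub>A\<^esub> a \<in> fst ` G" using G_inv by force
  show "\<And>a b. a \<in> fst ` G \<Longrightarrow> b \<in> fst ` G \<Longrightarrow> a \<otimes>\<^bsub>A\<^esub> b \<in> fst ` G"
    using G_mult by force
qed

lemma subgroup_goursat_bar2: "subgroup (snd ` G) B"
proof (rule B.subgroupI)
  show "snd ` G \<subseteq> carrier B" using G_memD by auto
  show "snd ` G \<noteq> {}" using G_one by auto
  show "\<And>a. a \<in> snd ` G \<Longrightarrow> inv\<^bsub>B\<^esub> a \<in> snd ` G" using G_inv by force
  show "\<And>a b. a \<in> snd ` G \<Longrightarrow> b \<in> snd ` G \<Longrightarrow> a \<otimes>\<^bsub>B\<^esub> b \<in> snd ` G"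
    using G_mult by force
qed

interpretation H: group "goursat_bar2 B G"
  unfolding goursat_bar2_def by (rule B.subgroup_imp_group[OF subgroup_goursat_bar2])

lemma normal_goursat_ker2: "goursat_ker2 A B G \<lhd> goursat_bar2 B G"
proof -
  have inv: "inv\<^bsub>goursat_bar2 B G\<^esub> x = inv\<^bsub>B\<^esub> x" if "x \<in> snd ` G" for x
    using B.m_inv_consistent[OF subgroup_goursat_bar2 that] by (simp add: goursat_bar2_def)
  have ker: "x \<in> goursat_ker2 A B G \<longleftrightarrow> (\<one>\<^bsub>A\<^esub>, x) \<in> G" for x
    using G_memD by (auto simp: goursat_ker2_def)
  have sub: "goursat_ker2 A B G \<subseteq> snd ` G" by (force simp: ker)
  have "subgroup (goursat_ker2 A B G) (goursat_bar2 B G)"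
  proof (rule H.subgroupI)
    show "goursat_ker2 A B G \<subseteq> carrier (goursat_bar2 B G)"
      using sub by (simp add: goursat_bar2_def)
    show "goursat_ker2 A B G \<noteq> {}" using G_one ker by auto
    show "inv\<^bsub>goursat_bar2 B G\<^esub> a \<in> goursat_ker2 A B G" if "a \<in> goursat_ker2 A B G" for a
      using G_inv[of "\<one>\<^bsub>A\<^esub>" a] that inv[OF subsetD[OF sub that]] by (simp add: ker)
    show "a \<otimes>\<^bsub>goursat_bar2 B G\<^esub> b \<in> goursat_ker2 A B G"
      if "a \<in> goursat_ker2 A B G" "b \<in> goursat_ker2 A B G" for a b
      using G_mult[of "\<one>\<^bsub>A\<^esub>" a "\<one>\<^bsub>A\<^esub>" b] that by (simp add: ker goursat_bar2_def)
  qed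
  moreover have "x \<otimes>\<^bsub>goursat_bar2 B G\<^esub> h \<otimes>\<^bsub>goursat_bar2 B G\<^esub> inv\<^bsub>goursat_bar2 B G\<^esub> x
      \<in> goursat_ker2 A B G"
    if x: "x \<in> carrier (goursat_bar2 B G)" and h: "h \<in> goursat_ker2 A B G" for x h
  proof -
    obtain a where a: "(a, x) \<in> G" using x by (auto simp: goursat_bar2_def)
    have "(a \<otimes>\<^bsub>A\<^esub> \<one>\<^bsub>A\<^esub> \<otimes>\<^bsub>A\<^esub> inv\<^bsub>A\<^esub> a, x \<otimes>\<^bsub>B\<^esub> h \<otimes>\<^bsub>B\<^esub> inv\<^bsub>B\<^esub> x) \<in> G"
      using a h by (intro G_mult G_inv) (auto simp: ker)
    then have "(\<one>\<^bsub>A\<^esub>, x \<otimes>\<^bsub>B\<^esub> h \<otimes>\<^bsub>B\<^esub> inv\<^bsub>B\<^esub> x) \<in> G" using G_memD[OF a] by simp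
    then show ?thesis using x inv[of x] by (simp add: ker goursat_bar2_def)
  qed
  ultimately show ?thesis by (simp add: H.normal_inv_iff)
qed

lemma goursat_theta_eq:
  assumes ab: "(a, b) \<in> G"
  shows "goursat_theta A B G a = goursat_class A B G b"
  unfolding goursat_theta_def
proof (rule the_equality)
  show "\<exists>b'. (a, b') \<in> G \<and> goursat_class A B G b = goursat_class A B G b'" using ab by blast
  fix c assume "\<exists>b'. (a, b') \<in> G \<and> c = goursat_class A B G b'"
  then obtain b' where b': "(a, b') \<in> G" and c: "c = goursat_class A B G b'" by blast
  note mem = G_memD[OF ab] G_memD[OF b']
  have "(a \<otimes>\<^bsub>A\<^esub> inv\<^bsub>A\<^esub> a, b' \<otimes>\<^bsub>B\<^esub> inv\<^bsub>B\<^esub> b) \<in> G" by (intro G_mult G_inv ab b')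
  then have k: "b' \<otimes>\<^bsub>B\<^esub> inv\<^bsub>B\<^esub> b \<in> goursat_ker2 A B G"
    using mem by (simp add: goursat_ker2_def)
  have "b' = (b' \<otimes>\<^bsub>B\<^esub> inv\<^bsub>B\<^esub> b) \<otimes>\<^bsub>B\<^esub> b" using mem by (simp add: B.m_assoc)
  then have "b' \<in> goursat_class A B G b"
    using k by (auto simp: goursat_class_def r_coset_def goursat_bar2_def)
  moreover have "b \<in> carrier (goursat_bar2 B G)" using ab by (force simp: goursat_bar2_def)
  ultimately show "c = goursat_class A B G b"
    unfolding c goursat_class_def
    using H.repr_independence normal_imp_subgroup[OF normal_goursat_ker2] by metis
qed

lemma goursat_theta_hom:
  "goursat_theta A B G \<in> hom (goursat_bar1 A G) (goursat_bar2 B G Mod goursat_ker2 A B G)"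
proof (rule homI)
  fix x assume "x \<in> carrier (goursat_bar1 A G)"
  then obtain b where b: "(x, b) \<in> G" by (auto simp: goursat_bar1_def)
  then have "b \<in> carrier (goursat_bar2 B G)" by (force simp: goursat_bar2_def)
  then show "goursat_theta A B G x \<in> carrier (goursat_bar2 B G Mod goursat_ker2 A B G)"
    by (auto simp: goursat_theta_eq[OF b] goursat_class_def FactGroup_def RCOSETS_def)
next
  fix x y assume "x \<in> carrier (goursat_bar1 A G)" "y \<in> carrier (goursat_bar1 A G)"
  then obtain b c where b: "(x, b) \<in> G" and c: "(y, c) \<in> G" by (auto simp: goursat_bar1_def)
  then have "b \<in> carrier (goursat_bar2 B G)" "c \<in> carrier (goursat_bar2 B G)"
    by (force simp: goursat_bar2_def)+
  from normal.rcos_sum[OF normal_goursat_ker2 this]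
  show "goursat_theta A B G (x \<otimes>\<^bsub>goursat_bar1 A G\<^esub> y) =
     goursat_theta A B G x \<otimes>\<^bsub>goursat_bar2 B G Mod goursat_ker2 A B G\<^esub> goursat_theta A B G y"
    using goursat_theta_eq[OF G_mult[OF b c]]
    by (simp add: goursat_theta_eq[OF b] goursat_theta_eq[OF c] goursat_class_def FactGroup_def
        goursat_bar1_def) (simp add: goursat_bar2_def)
qed

lemma goursat_theta_surj:
  "goursat_theta A B G ` carrier (goursat_bar1 A G) =
     carrier (goursat_bar2 B G Mod goursat_ker2 A B G)"
proof
  show "goursat_theta A B G ` carrier (goursat_bar1 A G)
      \<subseteq> carrier (goursat_bar2 B G Mod goursat_ker2 A B G)"
    using hom_carrier[OF goursat_theta_hom] .
  show "carrier (goursat_bar2 B G Mod goursat_ker2 A B G)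
      \<subseteq> goursat_theta A B G ` carrier (goursat_bar1 A G)"
  proof
    fix C assume "C \<in> carrier (goursat_bar2 B G Mod goursat_ker2 A B G)"
    then obtain a b where ab: "(a, b) \<in> G" and C: "C = goursat_class A B G b"
      by (auto simp: FactGroup_def RCOSETS_def goursat_class_def)
        (auto simp: goursat_bar2_def)
    have "a \<in> carrier (goursat_bar1 A G)" using ab by (force simp: goursat_bar1_def)
    then show "C \<in> goursat_theta A B G ` carrier (goursat_bar1 A G)"
      using goursat_theta_eq[OF ab] C by blast
  qed
qed

end

end

theory Submission
  imports Defs
begin

text \<open>
  A surjection from \<open>G\<close> onto a subgroup of \<open>A\<close> whose identification topology is compact carries
  exactly the subspace topology, because a compact topology cannot be strictly finer than a
  Hausdorff one. Hence in either direction all topologies in the Goursat decomposition are subspace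
  topologies, and being profinite amounts to being closed in \<open>A\<close>, \<open>B\<close> or \<open>A \<times>\<times> B\<close>. If \<open>G\<close> is
  closed, so are its projections and its fibre \<open>G\<^sub>2\<close>, and \<open>\<theta>\<^sub>1\<close> is continuous as it factors the
  continuous map \<open>(a, b) \<mapsto> [b]\<close> through an identification. Conversely \<open>G\<close> is the
  coincidence set of the continuous maps \<open>(a, b) \<mapsto> \<theta>\<^sub>1 a\<close> and \<open>(a, b) \<mapsto> [b]\<close> into a coset
  space that is Hausdorff because \<open>G\<^sub>2\<close> is closed.
\<close>

section \<open>Totally disconnected spaces\<close>

text \<open>A component is the largest connected set through its point. Speaking of all connected
  sets instead makes passage to subspaces and products immediate.\<close>

lemma totally_disconnected_space_connectedin:
  "totally_disconnected_space X \<longleftrightarrow>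
     (\<forall>S x y. connectedin X S \<longrightarrow> x \<in> S \<longrightarrow> y \<in> S \<longrightarrow> x = y)"
proof
  assume X: "totally_disconnected_space X"
  show "\<forall>S x y. connectedin X S \<longrightarrow> x \<in> S \<longrightarrow> y \<in> S \<longrightarrow> x = y"
  proof (intro allI impI)
    fix S x y assume S: "connectedin X S" "x \<in> S" "y \<in> S"
    then have "x \<in> topspace X" using connectedin_subset_topspace by blast
    moreover have "S \<subseteq> connected_component_of_set X x"
      using S by (simp add: connected_component_of_maximal)
    ultimately show "x = y" using X S by (auto simp: totally_disconnected_space_def)
  qed
next
  assume *: "\<forall>S x y. connectedin X S \<longrightarrow> x \<in> S \<longrightarrow> y \<in> S \<longrightarrow> x = y"
  have "connected_component_of_set X x = {x}" if "x \<in> topspace X" for x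
  proof -
    have "x \<in> connected_component_of_set X x"
      using that by (simp add: connected_component_of_refl)
    then show ?thesis using * connectedin_connected_component_of[of X x] by blast
  qed
  then show "totally_disconnected_space X" by (simp add: totally_disconnected_space_def)
qed

lemma totally_disconnected_space_subtopology:
  "totally_disconnected_space X \<Longrightarrow> totally_disconnected_space (subtopology X S)"
  by (auto simp: totally_disconnected_space_connectedin connectedin_subtopology)

text \<open>Both projections of a connected set are connected, so each contains a single
  point.\<close>

lemma totally_disconnected_space_prod_topology:
  assumes X: "totally_disconnected_space X" and Y: "totally_disconnected_space Y"
  shows "totally_disconnected_space (prod_topology X Y)"
  unfolding totally_disconnected_space_connectedin
proof (intro allI impI)
  fix S and p q :: "'a \<times> 'b"
  assume S: "connectedin (prod_topology X Y) S" and pq: "p \<in> S" "q \<in> S"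
  have "connectedin X (fst ` S)" "connectedin Y (snd ` S)"
    using S by (auto intro: connectedin_continuous_map_image continuous_map_fst continuous_map_snd)
  then have "fst p = fst q" "snd p = snd q"
    using X Y pq unfolding totally_disconnected_space_connectedin by blast+
  then show "p = q" by (simp add: prod_eq_iff)
qed

section \<open>Subgroups and products of topological and profinite groups\<close>

lemma topological_group_subgroup:
  assumes A: "topological_group A X" and H: "subgroup H A"
  shows "topological_group (A\<lparr>carrier := H\<rparr>) (subtopology X H)"
proof -
  interpret group A using A by (simp add: topological_group_def)
  have top: "topspace X = carrier A"
    and mult: "continuous_map (prod_topology X X) X (\<lambda>(x, y). x \<otimes>\<^bsub>A\<^esub> y)"
    and inv: "continuous_map X X (\<lambda>x. inv\<^bsub>A\<^esub> x)"
    using A by (auto simp: topological_group_def)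
  have H_top: "topspace (subtopology X H) = H"
    using subgroup.subset[OF H] top by auto
  have "continuous_map (prod_topology (subtopology X H) (subtopology X H)) (subtopology X H)
      (\<lambda>(x, y). x \<otimes>\<^bsub>A\<^esub> y)"
    unfolding subtopology_Times[symmetric]
    by (rule continuous_map_into_subtopology[OF continuous_map_from_subtopology[OF mult]])
      (auto intro: subgroup.m_closed[OF H])
  moreover have "continuous_map (subtopology X H) (subtopology X H) (\<lambda>x. inv\<^bsub>A\<^esub> x)"
    by (rule continuous_map_into_subtopology[OF continuous_map_from_subtopology[OF inv]])
      (auto intro: subgroup.m_inv_closed[OF H])
  \<comment> \<open>Inversion is recomputed in the record with carrier \<open>H\<close>; it agrees
    with inversion of \<open>A\<close> at the points of \<open>H\<close>.\<close>
  then have "continuous_map (subtopology X H) (subtopology X H) (\<lambda>x. inv\<^bsub>A\<lparr>carrier := H\<rparr>\<^esub> x)"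
    by (rule continuous_map_eq) (use H H_top in auto)
  ultimately show ?thesis
    using subgroup_imp_group[OF H] H_top by (simp add: topological_group_def)
qed

lemma topological_group_DirProd:
  assumes A: "topological_group A X" and B: "topological_group B Y"
  shows "topological_group (A \<times>\<times> B) (prod_topology X Y)"
proof -
  have grp: "group A" "group B" and top: "topspace X = carrier A" "topspace Y = carrier B"
    and mA: "continuous_map (prod_topology X X) X (\<lambda>(x, y). x \<otimes>\<^bsub>A\<^esub> y)"
    and mB: "continuous_map (prod_topology Y Y) Y (\<lambda>(x, y). x \<otimes>\<^bsub>B\<^esub> y)"
    and iA: "continuous_map X X (\<lambda>x. inv\<^bsub>A\<^esub> x)"
    and iB: "continuous_map Y Y (\<lambda>x. inv\<^bsub>B\<^esub> x)"
    using A B by (auto simp: topological_group_def)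
  let ?P = "prod_topology X Y"
  have pA: "continuous_map (prod_topology ?P ?P) (prod_topology X X)
      (\<lambda>z. (fst (fst z), fst (snd z)))"
    and pB: "continuous_map (prod_topology ?P ?P) (prod_topology Y Y)
      (\<lambda>z. (snd (fst z), snd (snd z)))"
    by (intro continuous_map_pairedI;
        rule continuous_map_compose[unfolded o_def, where X' = ?P];
        rule continuous_map_fst continuous_map_snd)+
  have mult: "continuous_map (prod_topology ?P ?P) ?P (\<lambda>(x, y). x \<otimes>\<^bsub>A \<times>\<times> B\<^esub> y)"
    using continuous_map_pairedI[OF continuous_map_compose[OF pA mA]
        continuous_map_compose[OF pB mB]]
    by (simp add: o_def case_prod_unfold DirProd_def)
  have "continuous_map ?P ?P (\<lambda>z. (inv\<^bsub>A\<^esub> (fst z), inv\<^bsub>B\<^esub> (snd z)))"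
    using continuous_map_pairedI[OF continuous_map_compose[OF continuous_map_fst iA]
        continuous_map_compose[OF continuous_map_snd iB]]
    by (simp add: o_def)
  then have "continuous_map ?P ?P (\<lambda>z. inv\<^bsub>A \<times>\<times> B\<^esub> z)"
    by (rule continuous_map_eq) (use grp top inv_DirProd[OF grp] in auto)
  then show ?thesis
    using mult grp top by (simp add: topological_group_def DirProd_group)
qed

text \<open>Hausdorffness and total disconnectedness pass to every subspace; closedness supplies
  compactness.\<close>

lemma profinite_group_closed_subgroup:
  assumes "profinite_group A X" and "subgroup H A" and "closedin X H"
  shows "profinite_group (A\<lparr>carrier := H\<rparr>) (subtopology X H)"
  using assms unfolding profinite_group_def
  by (auto intro: topological_group_subgroup Hausdorff_space_subtopology
      totally_disconnected_space_subtopology compact_space_subtopology closedin_compact_space)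

lemma profinite_group_DirProd:
  assumes "profinite_group A X" and "profinite_group B Y"
  shows "profinite_group (A \<times>\<times> B) (prod_topology X Y)"
  using assms unfolding profinite_group_def
  by (auto intro: topological_group_DirProd totally_disconnected_space_prod_topology
      simp: Hausdorff_space_prod_topology compact_space_prod_topology)

section \<open>Identification topologies on images\<close>

text \<open>The identity is a continuous bijection from the compact identification topology to the
  Hausdorff subspace topology, hence a homeomorphism. Compactness is asked of the image rather than
  of \<open>X\<close>, so that the lemma also applies when only the Goursat factors are known to be
  compact.\<close>

lemma quotient_topology_eq_subtopology:
  assumes f: "continuous_map X Z f" and Z: "Hausdorff_space Z"
    and comp: "compact_space (quotient_topology X f)"
  shows "quotient_topology X f = subtopology Z (f ` topspace X)"
    and "closedin Z (f ` topspace X)"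
proof -
  let ?Q = "quotient_topology X f" and ?S = "subtopology Z (f ` topspace X)"
  have sub: "f ` topspace X \<subseteq> topspace Z"
    using f by (rule continuous_map_image_subset_topspace)
  have "continuous_map ?Q Z id"
    by (rule continuous_compose_quotient_map[OF quotient_map_quotient_topology]) (simp add: f)
  then have id: "continuous_map ?Q ?S id"
    by (auto intro: continuous_map_into_subtopology simp: topspace_quotient_topology)
  have "homeomorphic_map ?Q ?S id"
    using sub by (intro continuous_imp_homeomorphic_map[OF id comp Hausdorff_space_subtopology[OF Z]])
      (auto simp: topspace_quotient_topology)
  then show eq: "?Q = ?S" by simp
  have "compactin Z (f ` topspace X)"
    using comp sub unfolding eq by (simp add: compactin_subspace)
  then show "closedin Z (f ` topspace X)" by (rule compactin_imp_closedin[OF Z])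
qed

lemma compact_space_quotient_topology:
  assumes "compact_space X"
  shows "compact_space (quotient_topology X f)"
  using image_compactin[OF assms[unfolded compact_space_def]
      quotient_imp_continuous_map[OF quotient_map_quotient_topology, of X f]]
  by (simp add: compact_space_def topspace_quotient_topology)

section \<open>Hausdorff coset spaces\<close>

text \<open>For points with distinct images, an open box \<open>U \<times> V\<close> around the pair
  avoids the closed relation. Then \<open>f\<close> sends \<open>U\<close> and \<open>V\<close> to
  disjoint sets, which are open because \<open>f\<close> is an open map.\<close>

lemma Hausdorff_space_open_quotient:
  assumes f: "quotient_map X Y f" and op: "open_map X Y f"
    and cl: "closedin (prod_topology X X) {(x, y). x \<in> topspace X \<and> y \<in> topspace X \<and> f x = f y}"
  shows "Hausdorff_space Y"
  unfolding Hausdorff_space_def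
proof (intro allI impI)
  fix p q assume pq: "p \<in> topspace Y \<and> q \<in> topspace Y \<and> p \<noteq> q"
  then obtain x y where xy: "x \<in> topspace X" "y \<in> topspace X" "p = f x" "q = f y"
    using quotient_imp_surjective_map[OF f] by (metis imageE)
  let ?R = "{(x, y). x \<in> topspace X \<and> y \<in> topspace X \<and> f x = f y}"
  have "openin (prod_topology X X) (topspace (prod_topology X X) - ?R)"
    using cl by blast
  moreover have "(x, y) \<in> topspace (prod_topology X X) - ?R" using xy pq by auto
  ultimately obtain U V where UV: "openin X U" "openin X V" "x \<in> U" "y \<in> V"
      "U \<times> V \<subseteq> topspace (prod_topology X X) - ?R"
    unfolding openin_prod_topology_alt by meson
  have "disjnt (f ` U) (f ` V)"
    using UV(5) openin_subset[OF UV(1)] openin_subset[OF UV(2)] by (force simp: disjnt_iff)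
  then show "\<exists>U V. openin Y U \<and> openin Y V \<and> p \<in> U \<and> q \<in> V \<and> disjnt U V"
    using op UV xy unfolding open_map_def by blast
qed

lemma (in group) rcoset_eq_iff:
  assumes "subgroup N G" and "x \<in> carrier G" and "y \<in> carrier G"
  shows "N #> x = N #> y \<longleftrightarrow> x \<otimes> inv y \<in> N"
proof -
  have "x \<in> N #> y \<longleftrightarrow> x \<otimes> inv y \<in> N"
    using subgroup.rcos_module[OF assms(1) is_group] assms by blast
  then show ?thesis using repr_independence[of x N y] rcos_self[of x N] assms by metis
qed

text \<open>The coset map is open, and its fibre relation is closed along with \<open>N\<close>, so
  the criterion for open quotients applies.\<close>

lemma Hausdorff_coset_space:
  assumes H: "topological_group H Z" and N: "subgroup N H" and cl: "closedin Z N"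
  shows "Hausdorff_space (quotient_topology Z (\<lambda>x. N #>\<^bsub>H\<^esub> x))"
proof -
  interpret H: group H using H by (simp add: topological_group_def)
  have top: "topspace Z = carrier H"
    and mult: "continuous_map (prod_topology Z Z) Z (\<lambda>(x, y). x \<otimes>\<^bsub>H\<^esub> y)"
    and inv: "continuous_map Z Z (\<lambda>x. inv\<^bsub>H\<^esub> x)"
    using H by (auto simp: topological_group_def)
  let ?f = "\<lambda>x. N #>\<^bsub>H\<^esub> x"
  have sub: "N \<subseteq> carrier H" by (rule subgroup.subset[OF N])
  have "open_map Z (quotient_topology Z ?f) ?f"
    unfolding open_map_def
  proof (intro allI impI)
    fix U assume U: "openin Z U"
    have UH: "U \<subseteq> carrier H" using openin_subset[OF U] top by simp
    \<comment> \<open>\<open>?W n\<close> is the translate of \<open>U\<close> by the inverse of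
      \<open>n\<close>. The union over \<open>n\<close> in \<open>N\<close> is the saturation of
      \<open>U\<close> under the coset map, so openness of all translates makes the image of
      \<open>U\<close> open.\<close>
    let ?W = "\<lambda>n. {x \<in> topspace Z. n \<otimes>\<^bsub>H\<^esub> x \<in> U}"
    have "openin Z (?W n)" if n: "n \<in> N" for n
    proof -
      have "continuous_map Z (prod_topology Z Z) (\<lambda>x. (n, x))"
        using n sub top by (intro continuous_map_pairedI) auto
      from continuous_map_compose[OF this mult]
      have "continuous_map Z Z (\<lambda>x. n \<otimes>\<^bsub>H\<^esub> x)" by (simp add: o_def)
      then show ?thesis using U by (rule openin_continuous_map_preimage)
    qed
    moreover have "{x \<in> topspace Z. ?f x \<in> ?f ` U} = (\<Union>n\<in>N. ?W n)"
    proof (intro equalityI subsetI)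
      fix x assume x: "x \<in> {x \<in> topspace Z. ?f x \<in> ?f ` U}"
      then obtain u where u: "u \<in> U" "?f u = ?f x" and xH: "x \<in> carrier H"
        using top by auto
      have "u \<in> ?f x" using H.rcos_self[OF _ N, of u] u UH by auto
      then show "x \<in> (\<Union>n\<in>N. ?W n)" using u xH top by (auto simp: r_coset_def)
    next
      fix x assume "x \<in> (\<Union>n\<in>N. ?W n)"
      then obtain n where n: "n \<in> N" "x \<in> carrier H" "n \<otimes>\<^bsub>H\<^esub> x \<in> U" using top by auto
      then have "n \<otimes>\<^bsub>H\<^esub> x \<in> ?f x" by (auto simp: r_coset_def)
      then have "?f x = ?f (n \<otimes>\<^bsub>H\<^esub> x)" using H.repr_independence[OF _ _ N] n by blast
      then show "x \<in> {x \<in> topspace Z. ?f x \<in> ?f ` U}" using n top by blast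
    qed
    ultimately show "openin (quotient_topology Z ?f) (?f ` U)"
      using UH top by (auto simp: openin_quotient_topology)
  qed
  moreover have "closedin (prod_topology Z Z)
      {(x, y). x \<in> topspace Z \<and> y \<in> topspace Z \<and> ?f x = ?f y}"
  proof -
    \<comment> \<open>By \<open>rcoset_eq_iff\<close> the relation is the preimage of
      \<open>N\<close> under the continuous map sending \<open>(x, y)\<close> to \<open>x\<close>
      times the inverse of \<open>y\<close>.\<close>
    have "continuous_map (prod_topology Z Z) (prod_topology Z Z) (\<lambda>z. (fst z, inv\<^bsub>H\<^esub> (snd z)))"
      by (intro continuous_map_pairedI continuous_map_fst
          continuous_map_compose[OF continuous_map_snd inv, unfolded o_def])
    from continuous_map_compose[OF this mult]
    have "continuous_map (prod_topology Z Z) Z (\<lambda>z. fst z \<otimes>\<^bsub>H\<^esub> inv\<^bsub>H\<^esub> (snd z))"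
      by (simp add: o_def)
    from closedin_continuous_map_preimage[OF this cl]
    show ?thesis
      by (rule back_subst[of "closedin _"]) (auto simp: top H.rcoset_eq_iff[OF N] cong: conj_cong)
  qed
  ultimately show ?thesis
    by (rule Hausdorff_space_open_quotient[OF quotient_map_quotient_topology])
qed

section \<open>Recovering a subgroup from its Goursat decomposition\<close>

text \<open>Exhibits \<open>G\<close> as the fibre product of its two projections over the coset
  space. If \<open>(a, b')\<close> is in \<open>G\<close> and \<open>b\<close> lies in the coset of
  \<open>b'\<close>, then \<open>(a, b)\<close> is the product of some \<open>(\<one>, n)\<close> in
  \<open>G\<close> with \<open>(a, b')\<close>.\<close>

lemma mem_goursat_iff:
  assumes "group A" and "group B" and "subgroup G (A \<times>\<times> B)"
    and a: "a \<in> fst ` G" and b: "b \<in> snd ` G"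
  shows "(a, b) \<in> G \<longleftrightarrow> goursat_theta A B G a = goursat_class A B G b"
proof
  show "(a, b) \<in> G \<Longrightarrow> goursat_theta A B G a = goursat_class A B G b"
    by (rule goursat_theta_eq[OF assms(1-3)])
  interpret A: group A by fact
  interpret B: group B by fact
  interpret H: group "goursat_bar2 B G"
    unfolding goursat_bar2_def
    by (rule B.subgroup_imp_group[OF subgroup_goursat_bar2[OF assms(1-3)]])
  assume eq: "goursat_theta A B G a = goursat_class A B G b"
  obtain b' where b': "(a, b') \<in> G" using a by auto
  have "goursat_class A B G b' = goursat_class A B G b"
    using eq goursat_theta_eq[OF assms(1-3) b'] by simp
  moreover have "b \<in> carrier (goursat_bar2 B G)" using b by (simp add: goursat_bar2_def)
  ultimately have "b \<in> goursat_class A B G b'"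
    unfolding goursat_class_def
    using H.rcos_self normal_imp_subgroup[OF normal_goursat_ker2[OF assms(1-3)]] by metis
  then obtain n where n: "(\<one>\<^bsub>A\<^esub>, n) \<in> G" "b = n \<otimes>\<^bsub>B\<^esub> b'"
    by (auto simp: goursat_class_def r_coset_def goursat_ker2_def goursat_bar2_def)
  have "a \<in> carrier A" using b' subgroup.subset[OF assms(3)] by (auto simp: DirProd_def)
  then show "(a, b) \<in> G"
    using subgroup.m_closed[OF assms(3) n(1) b'] n(2) by (simp add: DirProd_def)
qed

theorem proposition4p2:
  fixes A :: "('a, 'm) monoid_scheme" and X :: "'a topology"
    and B :: "('b, 'n) monoid_scheme" and Y :: "'b topology"
    and G :: "('a \<times> 'b) set"
  assumes "profinite_group A X"
    and "profinite_group B Y"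
    and "subgroup G (A \<times>\<times> B)"
  shows "profinite_group ((A \<times>\<times> B)\<lparr>carrier := G\<rparr>) (subtopology (prod_topology X Y) G)
    \<longleftrightarrow>
      profinite_group (goursat_bar1 A G) (goursat_bar1_topology X Y G) \<and>
      profinite_group (goursat_bar2 B G) (goursat_bar2_topology X Y G) \<and>
      profinite_group (goursat_2 A B G) (goursat_2_topology A B X Y G) \<and>
      continuous_map (goursat_bar1_topology X Y G) (goursat_quot_topology A B X Y G)
        (goursat_theta A B G)"
    (is "?L \<longleftrightarrow> ?R1 \<and> ?R2 \<and> ?R3 \<and> ?C")
proof -
  let ?P = "prod_topology X Y" and ?K = "goursat_ker2 A B G"
  let ?T = "subtopology ?P G"
  have tgA: "topological_group A X" and HX: "Hausdorff_space X"
    and tgB: "topological_group B Y" and HY: "Hausdorff_space Y"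
    and AB: "profinite_group (A \<times>\<times> B) ?P"
    using assms profinite_group_DirProd by (auto simp: profinite_group_def)
  then have A: "group A" and B: "group B" and HP: "Hausdorff_space ?P"
    and topX: "topspace X = carrier A" and topY: "topspace Y = carrier B"
    by (auto simp: topological_group_def profinite_group_def)
  note goursat = A B assms(3)
  interpret A: group A by (rule A)
  interpret B: group B by (rule B)
  have Gsub: "G \<subseteq> carrier A \<times> carrier B"
    using subgroup.subset[OF assms(3)] by (simp add: DirProd_def)
  have topT: "topspace ?T = G" using Gsub topX topY by auto
  have fst: "continuous_map ?T X fst" and snd: "continuous_map ?T Y snd"
    by (simp_all add: continuous_map_from_subtopology continuous_map_fst continuous_map_snd)
  have subgrp1: "subgroup (fst ` G) A" and subgrp2: "subgroup (snd ` G) B"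
    using subgroup_goursat_bar1[OF goursat] subgroup_goursat_bar2[OF goursat] .
  have K_snd: "?K \<subseteq> snd ` G" by (force simp: goursat_ker2_def)
  have K_bar2: "subgroup ?K (goursat_bar2 B G)"
    by (rule normal_imp_subgroup[OF normal_goursat_ker2[OF goursat]])
  have K_B: "subgroup ?K B"
    using B.incl_subgroup[OF subgrp2] K_bar2 by (simp add: goursat_bar2_def)
  note eq1 = quotient_topology_eq_subtopology[OF fst HX, folded goursat_bar1_topology_def,
      unfolded topT]
  note eq2 = quotient_topology_eq_subtopology[OF snd HY, folded goursat_bar2_topology_def,
      unfolded topT]
  have eq_ker: "goursat_2_topology A B X Y G = subtopology Y ?K"
    if "compact_space (goursat_bar2_topology X Y G)"
    using eq2(1)[OF that] K_snd
    by (simp add: goursat_2_topology_def subtopology_subtopology Int_absorb1)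
  have q1: "quotient_map ?T (goursat_bar1_topology X Y G) fst"
    and q2: "quotient_map ?T (goursat_bar2_topology X Y G) snd"
    and qc: "quotient_map (goursat_bar2_topology X Y G) (goursat_quot_topology A B X Y G)
      (goursat_class A B G)"
    by (simp_all add: goursat_bar1_topology_def goursat_bar2_topology_def
        goursat_quot_topology_def quotient_map_quotient_topology)
  have K_top: "?K \<subseteq> topspace Y" using topY by (auto simp: goursat_ker2_def)
  show ?thesis
  proof
    assume ?L
    then have comp: "compact_space ?T" by (simp add: profinite_group_def)
    then have "compactin ?P G" using Gsub topX topY by (simp add: compactin_subspace)
    then have clG: "closedin ?P G" by (rule compactin_imp_closedin[OF HP])
    have c1: "compact_space (goursat_bar1_topology X Y G)"
      and c2: "compact_space (goursat_bar2_topology X Y G)"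
      using comp by (simp_all add: goursat_bar1_topology_def goursat_bar2_topology_def
          compact_space_quotient_topology)
    have ?R1 unfolding goursat_bar1_def eq1(1)[OF c1]
      by (rule profinite_group_closed_subgroup[OF assms(1) subgrp1 eq1(2)[OF c1]])
    moreover have ?R2 unfolding goursat_bar2_def eq2(1)[OF c2]
      by (rule profinite_group_closed_subgroup[OF assms(2) subgrp2 eq2(2)[OF c2]])
    moreover have ?R3
    proof -
      \<comment> \<open>\<open>?K\<close> is the preimage of the closed set \<open>G\<close> under
        the embedding of \<open>Y\<close> as the slice over the identity of
        \<open>A\<close>.\<close>
      have "continuous_map Y ?P (\<lambda>b. (\<one>\<^bsub>A\<^esub>, b))"
        using topX by (intro continuous_map_pairedI) auto
      from closedin_continuous_map_preimage[OF this clG]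
      have "closedin Y ?K" by (simp add: goursat_ker2_def topY)
      then show ?thesis unfolding goursat_2_def eq_ker[OF c2]
        by (rule profinite_group_closed_subgroup[OF assms(2) K_B])
    qed
    moreover have ?C
    proof (rule continuous_compose_quotient_map[OF q1])
      \<comment> \<open>On \<open>G\<close>, \<open>goursat_theta\<close> after \<open>fst\<close>
        coincides with \<open>goursat_class\<close> after \<open>snd\<close>, a composite of
        identification maps.\<close>
      show "continuous_map ?T (goursat_quot_topology A B X Y G) (goursat_theta A B G \<circ> fst)"
        using continuous_map_compose[OF quotient_imp_continuous_map[OF q2]
            quotient_imp_continuous_map[OF qc]]
        by (rule continuous_map_eq) (use topT goursat_theta_eq[OF goursat] in auto)
    qed
    ultimately show "?R1 \<and> ?R2 \<and> ?R3 \<and> ?C" by blast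
  next
    assume R: "?R1 \<and> ?R2 \<and> ?R3 \<and> ?C"
    then have c1: "compact_space (goursat_bar1_topology X Y G)"
      and c2: "compact_space (goursat_bar2_topology X Y G)"
      and tg2: "topological_group (goursat_bar2 B G) (goursat_bar2_topology X Y G)"
      by (auto simp: profinite_group_def)
    let ?Q = "goursat_quot_topology A B X Y G"
    \<comment> \<open>The rectangle on which both maps to be compared are defined. By compactness
      its subspace topology is the product of the two identification topologies.\<close>
    let ?S = "subtopology ?P (fst ` G \<times> snd ` G)"
    \<comment> \<open>The profinite topology assumed on \<open>?K\<close> is its subspace topology
      from \<open>Y\<close>, so \<open>?K\<close> is compact and hence closed.\<close>
    have "compactin Y ?K"
      using R K_top by (simp add: eq_ker[OF c2] profinite_group_def compactin_subspace)
    then have "closedin (goursat_bar2_topology X Y G) ?K"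
      using K_snd unfolding eq2(1)[OF c2]
      by (intro closedin_subset_topspace compactin_imp_closedin[OF HY])
    then have HQ: "Hausdorff_space ?Q"
      using Hausdorff_coset_space[OF tg2 K_bar2]
      by (simp add: goursat_quot_topology_def goursat_class_def[abs_def])
    have S: "?S = prod_topology (goursat_bar1_topology X Y G) (goursat_bar2_topology X Y G)"
      by (simp add: subtopology_Times eq1(1)[OF c1] eq2(1)[OF c2])
    have "continuous_map ?S ?Q (goursat_theta A B G \<circ> fst)"
      "continuous_map ?S ?Q (goursat_class A B G \<circ> snd)"
      unfolding S using R
      by (auto intro: continuous_map_compose continuous_map_fst continuous_map_snd
          quotient_imp_continuous_map[OF qc])
    from closedin_continuous_maps_eq[OF HQ this]
    have "closedin ?S {z \<in> topspace ?S. goursat_theta A B G (fst z) = goursat_class A B G (snd z)}"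
      by simp
    moreover have "{z \<in> topspace ?S. goursat_theta A B G (fst z) = goursat_class A B G (snd z)} = G"
    proof (intro equalityI subsetI)
      fix z assume "z \<in> {z \<in> topspace ?S. goursat_theta A B G (fst z) = goursat_class A B G (snd z)}"
      then show "z \<in> G"
        using mem_goursat_iff[OF goursat, of "fst z" "snd z"] by (simp add: mem_Times_iff)
    next
      fix z assume z: "z \<in> G"
      then have "fst z \<in> fst ` G" "snd z \<in> snd ` G" by auto
      moreover from this have "goursat_theta A B G (fst z) = goursat_class A B G (snd z)"
        using mem_goursat_iff[OF goursat, of "fst z" "snd z"] z by simp
      ultimately show
        "z \<in> {z \<in> topspace ?S. goursat_theta A B G (fst z) = goursat_class A B G (snd z)}"
        using Gsub topX topY z by (auto simp: mem_Times_iff)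
    qed
    ultimately have "closedin ?S G" by simp
    \<comment> \<open>Closedness in the rectangle lifts to the whole product because both sides of
      the rectangle are closed, being compact in Hausdorff spaces.\<close>
    moreover have "closedin ?P (fst ` G \<times> snd ` G)"
      using eq1(2)[OF c1] eq2(2)[OF c2] by (simp add: closedin_prod_Times_iff)
    ultimately have "closedin ?P G" by (rule closedin_trans_full)
    then show ?L by (rule profinite_group_closed_subgroup[OF AB assms(3)])
  qed
qed

end
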